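(* For all $N\in(1,\infty)$ and $D\in(0,\infty)$: $$\pi^2N^2\,2^{-(N-1)}\ \ge\ D^2\,\lambda[h_{0,N,D}]\ \ge\ \frac14N^2\,2^{-(N-1)}.$$
   Context: $h_{0,N,D}:\mathbb R\to[0,\infty)$ is the density $h_{0,N,D}(x)=(D-x)^{N-1}$ for $x\in[0,D/2]$, $h_{0,N,D}(x)=x^{N-1}$ for $x\in[D/2,D]$, and $0$ outside $[0,D]$. For a non-negative density $h$ on $\mathbb R$, $$\lambda[h]:=\inf\Big\{\frac{\int_{\mathbb R}|f'|^2h\,dx}{\int_{\mathbb R} f^2h\,dx}: f:\mathbb R\to\mathbb R\text{ locally Lipschitz},\ \int fh\,dx=0,\ 0<\int f^2h\,dx<\infty\Big\}.$$ *)

theory Defs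
  imports "HOL-Analysis.Analysis"
begin

(* The two branches agree at x = D/2, so their order is immaterial. *)
definition h_dens :: "real \<Rightarrow> real \<Rightarrow> real \<Rightarrow> real" where
  "h_dens N D x =
     (if 0 \<le> x \<and> x \<le> D / 2 then (D - x) powr (N - 1)
      else if D / 2 \<le> x \<and> x \<le> D then x powr (N - 1)
      else 0)"

(* local_lipschitz is the library's notion for time-dependent maps; the time argument is a dummy. *)
definition locally_lipschitz :: "(real \<Rightarrow> real) \<Rightarrow> bool" where
  "locally_lipschitz f \<longleftrightarrow> local_lipschitz (UNIV :: real set) UNIV (\<lambda>_. f)"

(* Intended for measurable h \<ge> 0.  The mean-value condition demands integrability explicitly, since the
   Bochner integral of a non-integrable function is 0 by convention. *)
definition admissible :: "(real \<Rightarrow> real) \<Rightarrow> (real \<Rightarrow> real) \<Rightarrow> bool" where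
  "admissible h f \<longleftrightarrow>
     locally_lipschitz f \<and>
     integrable lebesgue (\<lambda>x. f x * h x) \<and> (\<integral>x. f x * h x \<partial>lebesgue) = 0 \<and>
     0 < (\<integral>\<^sup>+x. ennreal ((f x)\<^sup>2 * h x) \<partial>lebesgue) \<and>
     (\<integral>\<^sup>+x. ennreal ((f x)\<^sup>2 * h x) \<partial>lebesgue) < \<infinity>"

(* The integrals of non-negative functions are taken in [0, \<infinity>], so the Dirichlet energy may be infinite
   and the infimum over an empty class is \<infinity>.  A locally Lipschitz f is differentiable almost
   everywhere; deriv f has an unspecified value only on the null set where f is not differentiable. *)
definition spectral_gap :: "(real \<Rightarrow> real) \<Rightarrow> ennreal" where
  "spectral_gap h =
     (INF f \<in> {f. admissible h f}.
        (\<integral>\<^sup>+x. ennreal (\<bar>deriv f x\<bar>\<^sup>2 * h x) \<partial>lebesgue) /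
        (\<integral>\<^sup>+x. ennreal ((f x)\<^sup>2 * h x) \<partial>lebesgue))"

end

(* Both bounds concern one half [D/2, D], where the density is x^(N-1) with its bottleneck at the
   centre D/2.

   Lower bound: Cauchy-Schwarz applied to f x - f (D/2) = \<integral> f' gives
   (f x - f (D/2))^2 \<le> (\<integral> f'^2 h) (\<integral> 1/h over a half interval).  Integrating against h bounds
   \<integral> (f - f (D/2))^2 h, which dominates \<integral> f^2 h because f has h-mean zero.  The fundamental theorem
   for a Lipschitz f comes from Radon-Nikodym: x \<mapsto> f x + 2 L x is a bi-Lipschitz homeomorphism, so
   the push-forward of Lebesgue measure under its inverse is absolutely continuous; Lebesgue
   differentiation of the density then recovers deriv f almost everywhere.

   Upper bound: for N \<le> 3 the function cos (pi x / D) has Rayleigh quotient at most pi^2 / D^2, since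
   cos (2 pi x / D) and h are similarly ordered, and 2^(N-1) \<le> N^2.  For N \<ge> 3 the piecewise linear
   function rising from -1 to 1 within distance D/(2N) of the centre suffices. *)
theory Submission
  imports Defs
begin

subsection \<open>Lipschitz functions as indefinite integrals\<close>

text \<open>Adding the slope \<open>2 * L\<close> makes the function increase at rate at least
  \<open>L\<close>, so its increments define a positive measure to which Radon-Nikodym applies; the
  slope is subtracted from the density at the end. \<open>g\<close> is kept Borel measurable because
  Lebesgue integrals of it are taken later.\<close>

lemma lipschitz_density:
  fixes f :: "real \<Rightarrow> real"
  assumes lip: "L-lipschitz_on UNIV f" and "0 < L"
  obtains g where "g \<in> borel_measurable borel"
    "\<And>a b. a \<le> b \<Longrightarrow> (g has_integral (f b - f a)) {a..b}"
proof -
  define F where "F = (\<lambda>x. f x + 2 * L * x)"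
  have fL: "\<bar>f y - f x\<bar> \<le> L * \<bar>y - x\<bar>" for x y
    using lipschitz_onD[OF lip, of y x] by (simp add: dist_real_def)
  have Fmono: "L * (y - x) \<le> F y - F x" if "x \<le> y" for x y
    using fL[of y x] that by (simp add: F_def algebra_simps abs_le_iff)
  have Fup: "\<bar>F y - F x\<bar> \<le> 3 * L * \<bar>y - x\<bar>" for x y
  proof -
    have "F y - F x = (f y - f x) + 2 * L * (y - x)" by (simp add: F_def algebra_simps)
    also have "\<bar>\<dots>\<bar> \<le> \<bar>f y - f x\<bar> + \<bar>2 * L * (y - x)\<bar>" by (rule abs_triangle_ineq)
    also have "\<dots> \<le> 3 * L * \<bar>y - x\<bar>" using fL[of y x] \<open>0 < L\<close> by (simp add: abs_mult)
    finally show ?thesis .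
  qed
  have Fstrict: "strict_mono F"
  proof (rule strict_monoI)
    fix x y :: real assume "x < y"
    then have "0 < L * (y - x)" using \<open>0 < L\<close> by simp
    then show "F x < F y" using Fmono[of x y] \<open>x < y\<close> by linarith
  qed
  have contF: "continuous_on S F" for S
    unfolding F_def
    by (intro continuous_intros continuous_on_subset[OF lipschitz_on_continuous_on[OF lip]]) auto
  \<comment> \<open>Since \<open>F\<close> has slope at least \<open>L\<close>, it reaches
    \<open>y\<close> within distance |y - F 0| / L of 0, on one side or the other.\<close>
  have "\<exists>x. F x = y" for y
  proof -
    define t where "t = \<bar>y - F 0\<bar> / L"
    have "0 \<le> t" and Lt: "L * t = \<bar>y - F 0\<bar>" using \<open>0 < L\<close> by (auto simp: t_def)
    have "F (-t) \<le> y" using Fmono[of "-t" 0] \<open>0 \<le> t\<close> Lt by simp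
    moreover have "y \<le> F t" using Fmono[of 0 t] \<open>0 \<le> t\<close> Lt by simp
    ultimately show ?thesis using IVT'[of F "-t" y t] \<open>0 \<le> t\<close> contF by auto
  qed
  then have surj: "surj F" by (metis surjI)
  define G where "G = inv F"
  have FG: "F (G y) = y" for y unfolding G_def using surj by (rule surj_f_inv_f)
  have GF: "G (F x) = x" for x
    unfolding G_def using Fstrict by (simp add: strict_mono_imp_inj_on)
  have Fle: "F x \<le> F y \<longleftrightarrow> x \<le> y" for x y using Fstrict by (rule strict_mono_less_eq)
  have "mono G" by (rule monoI) (metis FG Fle)
  then have [measurable]: "G \<in> borel_measurable borel" by (rule borel_measurable_mono)
  \<comment> \<open>The Lebesgue-Stieltjes measure of \<open>F\<close>: the preimage of [a, b] under
    \<open>G\<close> is [F a, F b].\<close>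
  define \<mu> where "\<mu> = distr lborel borel G"
  have \<mu>_Icc: "emeasure \<mu> {a..b} = ennreal (F b - F a)" if "a \<le> b" for a b
  proof -
    have "G -` {a..b} = {F a..F b}"
      by (auto simp: set_eq_iff) (metis FG Fle)+
    then show ?thesis using Fle that by (simp add: \<mu>_def emeasure_distr)
  qed
  \<comment> \<open>Here the upper slope \<open>3 * L\<close> enters: a Lipschitz map sends null
    sets to null sets, and the preimage of a set under \<open>G\<close> is its image under
    \<open>F\<close>.\<close>
  have ac: "absolutely_continuous lborel \<mu>"
    unfolding absolutely_continuous_def
  proof
    fix A :: "real set" assume A: "A \<in> null_sets lborel"
    then have [measurable]: "A \<in> sets borel" by auto
    have "negligible A" using A by (simp add: negligible_iff_null_sets null_sets_completionI)
    then have "negligible (F ` A)"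
      by (rule negligible_locally_Lipschitz_image[rotated])
        (use Fup in \<open>auto intro!: exI[of _ UNIV] exI[of _ "3 * L"]\<close>)
    moreover have "F ` A = G -` A" by (auto simp: GF image_iff) (metis FG)
    moreover have "G -` A \<in> sets borel" using measurable_sets[of G borel borel A] by simp
    ultimately have "emeasure lborel (G -` A) = 0"
      by (metis negligible_iff_null_sets null_sets_completion_iff null_setsD1 sets_lborel)
    then show "A \<in> null_sets \<mu>" by (simp add: \<mu>_def null_sets_def emeasure_distr)
  qed
  obtain p where p[measurable]: "p \<in> borel_measurable lborel" and dens: "density lborel p = \<mu>"
    using sigma_finite_measure.Radon_Nikodym[OF sigma_finite_lborel ac] by (auto simp: \<mu>_def)
  have pI: "(\<integral>\<^sup>+x. p x * indicator {a..b} x \<partial>lborel) = ennreal (F b - F a)" if "a \<le> b" for a b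
    using \<mu>_Icc[OF that] by (simp add: dens[symmetric] emeasure_density)
  \<comment> \<open>\<open>enn2real\<close> sends infinity to 0, so \<open>q\<close> may replace
    \<open>p\<close> under the integral only where \<open>p\<close> is finite. That is almost
    everywhere, since \<open>p\<close> has finite integral over each [-n, n].\<close>
  have "AE x in lborel. \<forall>n::nat. p x * indicator {-real n..real n} x \<noteq> \<infinity>"
    unfolding AE_all_countable
  proof
    fix n :: nat
    show "AE x in lborel. p x * indicator {-real n..real n} x \<noteq> \<infinity>"
      by (rule nn_integral_PInf_AE) (use pI[of "-real n" "real n"] in auto)
  qed
  then have pfin: "AE x in lborel. p x \<noteq> \<infinity>"
  proof (rule AE_mp, intro AE_I2 impI)
    fix x :: real assume *: "\<forall>n::nat. p x * indicator {-real n..real n} x \<noteq> \<infinity>"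
    obtain n :: nat where "\<bar>x\<bar> \<le> real n" using real_arch_simple by blast
    then show "p x \<noteq> \<infinity>" using *[rule_format, of n] by (auto simp: indicator_def abs_le_iff)
  qed
  define q where "q = (\<lambda>x. enn2real (p x))"
  have qI: "(q has_integral (F b - F a)) {a..b}" if "a \<le> b" for a b
  proof -
    have "((\<lambda>x. if x \<in> {a..b} then q x else 0) has_integral (F b - F a)) UNIV"
    proof (rule nn_integral_has_integral)
      show "(\<lambda>x. if x \<in> {a..b} then q x else 0) \<in> borel_measurable borel"
        unfolding q_def using p by measurable
      show "0 \<le> F b - F a" using Fle that by simp
      have "(\<integral>\<^sup>+x. ennreal (if x \<in> {a..b} then q x else 0) \<partial>lborel)
          = (\<integral>\<^sup>+x. p x * indicator {a..b} x \<partial>lborel)"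
        using pfin by (intro nn_integral_cong_AE)
          (auto elim!: eventually_mono simp: q_def indicator_def less_top)
      then show "(\<integral>\<^sup>+x. ennreal (if x \<in> {a..b} then q x else 0) \<partial>lborel) = ennreal (F b - F a)"
        using pI[OF that] by simp
    qed (simp add: q_def)
    then show ?thesis by (simp only: has_integral_restrict_UNIV)
  qed
  show ?thesis
  proof
    show "(\<lambda>x. q x - 2 * L) \<in> borel_measurable borel" unfolding q_def using p by measurable
    show "((\<lambda>x. q x - 2 * L) has_integral (f b - f a)) {a..b}" if "a \<le> b" for a b
      using has_integral_diff[OF qI[OF that] has_integral_const_real[of "2 * L" a b]] that
      by (simp add: F_def algebra_simps)
  qed
qed

text \<open>The Lebesgue differentiation result \<open>integrable_ccontinuous_explicit\<close>
  concerns averages over cubes with lower corner at \<open>x\<close>, on the line the intervals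
  [x, x + h] with h > 0. It thus controls right-hand difference quotients.\<close>

lemma indefinite_integral_right_derivative:
  fixes f g :: "real \<Rightarrow> real"
  assumes I: "\<And>a b. a \<le> b \<Longrightarrow> (g has_integral (f b - f a)) {a..b}"
  obtains N where "negligible N"
    "\<And>x. x \<notin> N \<Longrightarrow> (f has_real_derivative g x) (at_right x)"
proof -
  have "g integrable_on cbox a b" for a b
    using I[of a b] by (cases "a \<le> b") (auto simp: integrable_on_def)
  then obtain N where "negligible N" and
    N: "\<And>x e. \<lbrakk>x \<notin> N; 0 < e\<rbrakk> \<Longrightarrow> \<exists>d>0. \<forall>h. 0 < h \<and> h < d \<longrightarrow>
        norm (integral (cbox x (x + h *\<^sub>R One)) g /\<^sub>R h ^ DIM(real) - g x) < e"
    using integrable_ccontinuous_explicit[of g] by metis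
  show ?thesis
  proof
    show "negligible N" by fact
    fix x assume "x \<notin> N"
    show "(f has_real_derivative g x) (at_right x)"
      unfolding has_field_derivative_iff
    proof (rule tendstoI)
      fix e :: real assume "0 < e"
      then obtain d where "d > 0" and
        d: "\<And>h. 0 < h \<Longrightarrow> h < d \<Longrightarrow> norm (integral (cbox x (x + h *\<^sub>R One)) g /\<^sub>R h ^ DIM(real) - g x) < e"
        using N[OF \<open>x \<notin> N\<close>] by meson
      have "dist ((f y - f x) / (y - x)) (g x) < e" if "x < y" "y < x + d" for y
        using d[of "y - x"] that integral_unique[OF I[of x y]]
        by (simp add: dist_real_def divide_inverse mult.commute)
      then show "\<forall>\<^sub>F y in at_right x. dist ((f y - f x) / (y - x)) (g x) < e"
        unfolding eventually_at_right_field using \<open>d > 0\<close> by (intro exI[of _ "x + d"]) auto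
    qed
  qed
qed

text \<open>The left derivative of \<open>f\<close> at \<open>x\<close> is the right derivative of y
  -> - f (- y) at \<open>- x\<close>. The one-sided result is therefore applied to \<open>f\<close>
  and to this reflection, and the exceptional set joins the first null set with the mirror image of
  the second.\<close>

lemma indefinite_integral_derivative:
  fixes f g :: "real \<Rightarrow> real"
  assumes I: "\<And>a b. a \<le> b \<Longrightarrow> (g has_integral (f b - f a)) {a..b}"
  obtains N where "negligible N" "\<And>x. x \<notin> N \<Longrightarrow> (f has_real_derivative g x) (at x)"
proof -
  obtain N1 where N1: "negligible N1" "\<And>x. x \<notin> N1 \<Longrightarrow> (f has_real_derivative g x) (at_right x)"
    using indefinite_integral_right_derivative[OF I] by metis
  have I': "((\<lambda>x. g (- x)) has_integral (- f (- b) - (- f (- a)))) {a..b}" if "a \<le> b" for a b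
    using has_integral_reflect_lemma_real[OF I[of "-b" "-a"]] that by simp
  obtain N2 where N2: "negligible N2"
    "\<And>x. x \<notin> N2 \<Longrightarrow> ((\<lambda>x. - f (- x)) has_real_derivative g (- x)) (at_right x)"
    using indefinite_integral_right_derivative[where f="\<lambda>x. - f (- x)" and g="\<lambda>x. g (-x)", OF I'] by metis
  have neg: "negligible (N1 \<union> uminus ` N2)"
    by (intro negligible_Un N1 negligible_differentiable_image_negligible N2)
      (auto intro!: derivative_intros)
  show ?thesis
  proof
    show "negligible (N1 \<union> uminus ` N2)" by (rule neg)
    fix x assume x: "x \<notin> N1 \<union> uminus ` N2"
    then have "- x \<notin> N2" by force
    then have "((\<lambda>y. (- f (- y) - (- f x)) / (y + x)) \<longlongrightarrow> g x) (at_right (- x))"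
      using N2(2)[of "-x"] by (simp add: has_field_derivative_iff)
    then have "((\<lambda>y. (f y - f x) / (y - x)) \<longlongrightarrow> g x) (at_left x)"
      unfolding filterlim_at_left_to_right
      by (rule Lim_transform_eventually)
        (auto intro!: always_eventually simp: field_simps divide_simps)
    moreover have "((\<lambda>y. (f y - f x) / (y - x)) \<longlongrightarrow> g x) (at_right x)"
      using N1(2)[of x] x by (simp add: has_field_derivative_iff)
    ultimately show "(f has_real_derivative g x) (at x)"
      by (simp add: has_field_derivative_iff filterlim_at_split)
  qed
qed

text \<open>On the compact interval \<open>f\<close> is Lipschitz, and freezing it at its end values
  outside [a, b] gives a globally Lipschitz function with the same constant. The two coincide near
  interior points only, hence the strict inequalities in the claim about
  \<open>deriv f\<close>.\<close>

lemma locally_lipschitz_density: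
  assumes lip: "locally_lipschitz f" and "a \<le> b"
  obtains g where "g \<in> borel_measurable borel"
    "AE x in lborel. a < x \<and> x < b \<longrightarrow> deriv f x = g x"
    "\<And>x y. \<lbrakk>a \<le> x; x \<le> y; y \<le> b\<rbrakk> \<Longrightarrow> (g has_integral (f y - f x)) {x..y}"
proof -
  have "local_lipschitz {0::real} {a..b} (\<lambda>_. f)"
    using lip unfolding locally_lipschitz_def by (rule local_lipschitz_subset) auto
  then obtain L where "L-lipschitz_on {a..b} f"
    by (rule local_lipschitz_compact_implies_lipschitz[where X = "{a..b}" and T = "{0}"]) auto
  \<comment> \<open>The constant is enlarged to be strictly positive, as
    \<open>lipschitz_density\<close> demands.\<close>
  then have L: "(\<bar>L\<bar> + 1)-lipschitz_on {a..b} f" by (rule lipschitz_on_le) simp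
  define k where "k = (\<lambda>x. f (max a (min b x)))"
  have "(\<bar>L\<bar> + 1)-lipschitz_on UNIV k"
  proof (rule lipschitz_onI)
    fix x y :: real
    have "dist (k x) (k y) \<le> (\<bar>L\<bar> + 1) * dist (max a (min b x)) (max a (min b y))"
      unfolding k_def using \<open>a \<le> b\<close> by (intro lipschitz_onD[OF L]) auto
    also have "\<dots> \<le> (\<bar>L\<bar> + 1) * dist x y"
      by (intro mult_left_mono) (auto simp: dist_real_def)
    finally show "dist (k x) (k y) \<le> (\<bar>L\<bar> + 1) * dist x y" .
  qed simp
  then obtain g where g: "g \<in> borel_measurable borel"
    "\<And>x y. x \<le> y \<Longrightarrow> (g has_integral (k y - k x)) {x..y}"
    by (rule lipschitz_density) auto
  obtain N where N: "negligible N" "\<And>x. x \<notin> N \<Longrightarrow> (k has_real_derivative g x) (at x)"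
    using indefinite_integral_derivative[OF g(2)] by metis
  have kf: "k x = f x" if "x \<in> {a..b}" for x using that by (simp add: k_def)
  have fd: "deriv f x = g x" if "x \<notin> N" "x \<in> {a<..<b}" for x
  proof (rule DERIV_imp_deriv)
    show "(f has_real_derivative g x) (at x)"
      by (rule has_field_derivative_transform_within_open[OF N(2)[OF that(1)] _ that(2)])
        (auto intro!: kf)
  qed
  have "AE x in lebesgue. x \<notin> N"
    using N(1) by (simp add: negligible_iff_null_sets AE_not_in)
  then have "AE x in lborel. x \<notin> N" by (simp add: AE_completion_iff)
  then have "AE x in lborel. a < x \<and> x < b \<longrightarrow> deriv f x = g x"
    by (rule eventually_mono) (use fd in auto)
  moreover have "(g has_integral (f y - f x)) {x..y}" if "a \<le> x" "x \<le> y" "y \<le> b" for x y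
    using g(2)[of x y] that by (simp add: kf)
  ultimately show ?thesis using that g(1) by blast
qed

text \<open>\<open>has_integral\<close> is the Henstock-Kurzweil integral, which may exist without
  absolute convergence. If |g| has infinite integral the bound is trivial; otherwise
  \<open>g\<close> is Lebesgue integrable on [x, y] and the two integrals agree.\<close>

lemma norm_has_integral_le_nn_integral:
  fixes g :: "real \<Rightarrow> real"
  assumes [measurable]: "g \<in> borel_measurable borel" and I: "(g has_integral d) {x..y}"
  shows "ennreal \<bar>d\<bar> \<le> (\<integral>\<^sup>+t. ennreal \<bar>g t\<bar> * indicator {x..y} t \<partial>lborel)"
proof (cases "(\<integral>\<^sup>+t. ennreal \<bar>g t\<bar> * indicator {x..y} t \<partial>lborel) < \<infinity>")
  case True
  have eq: "(\<integral>\<^sup>+t. ennreal (norm (if t \<in> {x..y} then g t else 0)) \<partial>lborel)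
      = (\<integral>\<^sup>+t. ennreal \<bar>g t\<bar> * indicator {x..y} t \<partial>lborel)"
    by (intro nn_integral_cong) (auto simp: indicator_def)
  have int: "integrable lborel (\<lambda>t. if t \<in> {x..y} then g t else 0)"
    by (rule integrableI_bounded) (use True in \<open>simp_all only: eq, measurable\<close>)
  have "((\<lambda>t. if t \<in> {x..y} then g t else 0) has_integral d) UNIV"
    using I by (simp only: has_integral_restrict_UNIV)
  with has_integral_integral_lborel[OF int]
  have "d = (\<integral>t. (if t \<in> {x..y} then g t else 0) \<partial>lborel)"
    by (rule has_integral_unique[rotated])
  then show ?thesis using integral_norm_bound_ennreal[OF int] unfolding eq by simp
qed (simp add: not_less top_unique)

text \<open>Cauchy-Schwarz for the factorisation |f'| = (|f'| sqrt h) (1 / sqrt h). The energy is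
  taken over the whole line, so that one and the same number serves for every interval
  [a, b].\<close>

lemma locally_lipschitz_weighted_bound:
  assumes lip: "locally_lipschitz f" and "a \<le> b"
    and [measurable]: "h \<in> borel_measurable borel" and pos: "\<And>t. a \<le> t \<Longrightarrow> t \<le> b \<Longrightarrow> 0 < h t"
  shows "ennreal ((f b - f a)\<^sup>2)
     \<le> (\<integral>\<^sup>+t. ennreal (\<bar>deriv f t\<bar>\<^sup>2 * h t) \<partial>lborel)
       * (\<integral>\<^sup>+t. ennreal (1 / h t) * indicator {a..b} t \<partial>lborel)"
proof -
  obtain g where [measurable]: "g \<in> borel_measurable borel"
    and AE: "AE x in lborel. a < x \<and> x < b \<longrightarrow> deriv f x = g x"
    and g: "\<And>x y. \<lbrakk>a \<le> x; x \<le> y; y \<le> b\<rbrakk> \<Longrightarrow> (g has_integral (f y - f x)) {x..y}"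
    using locally_lipschitz_density[OF lip \<open>a \<le> b\<close>] by metis
  define u v where "u = (\<lambda>t. ennreal (\<bar>g t\<bar> * sqrt (h t)) * indicator {a..b} t)"
    and "v = (\<lambda>t. ennreal (1 / sqrt (h t)) * indicator {a..b} t)"
  have [measurable]: "u \<in> borel_measurable borel" "v \<in> borel_measurable borel"
    unfolding u_def v_def by measurable
  have "ennreal \<bar>f b - f a\<bar> \<le> (\<integral>\<^sup>+t. ennreal \<bar>g t\<bar> * indicator {a..b} t \<partial>lborel)"
    using norm_has_integral_le_nn_integral[OF _ g[of a b]] \<open>a \<le> b\<close> by simp
  also have "\<dots> = (\<integral>\<^sup>+t. u t * v t \<partial>lborel)"
  proof (intro nn_integral_cong)
    fix t
    show "ennreal \<bar>g t\<bar> * indicator {a..b} t = u t * v t"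
      using pos[of t] by (auto simp: u_def v_def indicator_def ennreal_mult'[symmetric])
  qed
  finally have "(ennreal \<bar>f b - f a\<bar>)\<^sup>2 \<le> (\<integral>\<^sup>+t. u t * v t \<partial>lborel)\<^sup>2"
    by (rule power_mono) simp
  also have "\<dots> \<le> (\<integral>\<^sup>+t. (u t)\<^sup>2 \<partial>lborel) * (\<integral>\<^sup>+t. (v t)\<^sup>2 \<partial>lborel)"
    by (rule Cauchy_Schwarz_nn_integral) auto
  also have "(\<integral>\<^sup>+t. (v t)\<^sup>2 \<partial>lborel) = (\<integral>\<^sup>+t. ennreal (1 / h t) * indicator {a..b} t \<partial>lborel)"
  proof (intro nn_integral_cong)
    fix t
    show "(v t)\<^sup>2 = ennreal (1 / h t) * indicator {a..b} t"
      using pos[of t] by (auto simp: v_def indicator_def ennreal_power power_divide)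
  qed
  also have "(\<integral>\<^sup>+t. (u t)\<^sup>2 \<partial>lborel) \<le> (\<integral>\<^sup>+t. ennreal (\<bar>deriv f t\<bar>\<^sup>2 * h t) \<partial>lborel)"
  proof (rule nn_integral_mono_AE)
    \<comment> \<open>\<open>deriv f\<close> is known to equal \<open>g\<close> only inside the open
      interval, so the endpoints are discarded as a null set.\<close>
    have ne: "AE t in lborel. t \<noteq> a" "AE t in lborel. t \<noteq> b"
      by (rule AE_lborel_singleton)+
    show "AE t in lborel. (u t)\<^sup>2 \<le> ennreal (\<bar>deriv f t\<bar>\<^sup>2 * h t)"
      using AE ne
    proof eventually_elim
      case (elim t)
      then show ?case using pos[of t]
        by (cases "t \<in> {a..b}") (auto simp: u_def ennreal_power power_mult_distrib)
    qed
  qed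
  finally show ?thesis by (simp add: ennreal_power mult_right_mono)
qed

subsection \<open>The lower bound\<close>

lemma nn_integral_powr_Icc:
  fixes a b s :: real
  assumes "0 < a" "a \<le> b" "s \<noteq> - 1"
  shows "(\<integral>\<^sup>+x. ennreal (x powr s) * indicator {a..b} x \<partial>lborel)
       = ennreal ((b powr (s + 1) - a powr (s + 1)) / (s + 1))"
proof -
  have "((\<lambda>x. x powr s) has_integral
      (b powr (s + 1) / (s + 1) - a powr (s + 1) / (s + 1))) {a..b}"
    using assms
    by (intro fundamental_theorem_of_calculus)
      (auto intro!: derivative_eq_intros simp: has_real_derivative_iff_has_vector_derivative[symmetric])
  then show ?thesis
    by (simp add: nn_integral_has_integral_lebesgue' diff_divide_distrib)
qed

lemma nn_integral_lborel_reflect: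
  fixes F :: "real \<Rightarrow> ennreal"
  assumes "F \<in> borel_measurable borel"
  shows "(\<integral>\<^sup>+x. F (D - x) \<partial>lborel) = (\<integral>\<^sup>+x. F x \<partial>lborel)"
  using nn_integral_real_affine[OF assms, of "-1" D] by simp

lemma borel_measurable_h_dens [measurable]: "h_dens N D \<in> borel_measurable borel"
  unfolding h_dens_def by measurable

lemma h_dens_reflect: "h_dens N D (D - x) = h_dens N D x"
  by (auto simp: h_dens_def field_simps)

lemma h_dens_nonneg [simp]: "0 \<le> h_dens N D x"
  by (simp add: h_dens_def)

lemma h_dens_pos: "0 < D \<Longrightarrow> 0 \<le> x \<Longrightarrow> x \<le> D \<Longrightarrow> 0 < h_dens N D x"
  by (auto simp: h_dens_def)

lemma h_dens_upper_half: "0 < D \<Longrightarrow> D / 2 \<le> x \<Longrightarrow> x \<le> D \<Longrightarrow> h_dens N D x = x powr (N - 1)"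
  by (auto simp: h_dens_def)

lemma h_dens_outside: "x < 0 \<or> D < x \<Longrightarrow> 0 < D \<Longrightarrow> h_dens N D x = 0"
  by (auto simp: h_dens_def)

text \<open>By reflection the mass is twice that of x^(N-1) on [D/2, D], that is 2 (D^N - (D/2)^N) /
  N; the subtracted term is dropped.\<close>

lemma nn_integral_h_dens_le:
  assumes "1 < N" "0 < D"
  shows "(\<integral>\<^sup>+x. ennreal (h_dens N D x) \<partial>lborel) \<le> ennreal (2 * D powr N / N)"
proof -
  define k where "k = (\<lambda>x. ennreal (x powr (N - 1)) * indicator {D/2..D} x)"
  have [measurable]: "k \<in> borel_measurable borel" unfolding k_def by measurable
  have "(\<integral>\<^sup>+x. ennreal (h_dens N D x) \<partial>lborel) \<le> (\<integral>\<^sup>+x. k x + k (D - x) \<partial>lborel)"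
    by (intro nn_integral_mono) (auto simp: k_def h_dens_def indicator_def)
  also have "\<dots> = (\<integral>\<^sup>+x. k x \<partial>lborel) + (\<integral>\<^sup>+x. k (D - x) \<partial>lborel)"
    by (rule nn_integral_add) auto
  also have "\<dots> = 2 * (\<integral>\<^sup>+x. k x \<partial>lborel)"
    by (simp add: nn_integral_lborel_reflect mult_2)
  also have "(\<integral>\<^sup>+x. k x \<partial>lborel) = ennreal ((D powr N - (D/2) powr N) / N)"
    unfolding k_def using assms by (subst nn_integral_powr_Icc) auto
  also have "\<dots> \<le> ennreal (D powr N / N)"
    using assms by (intro ennreal_leI divide_right_mono) auto
  also have "2 * ennreal (D powr N / N) = ennreal (2 * (D powr N / N))"
    using assms by (subst ennreal_mult) auto
  finally show ?thesis by (simp add: mult_left_mono)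
qed

text \<open>For N <= 4 the integrand is at most its value at D/2, which gives (D/2)^(2-N), and 1 <=
  4/N. For N > 4 the antiderivative gives at most (D/2)^(2-N) / (N-2), and 1/(N-2) <= 4/N. The split
  keeps the exponent -1, at N = 2, away from the antiderivative.\<close>

lemma nn_integral_inverse_h_dens_le:
  assumes "1 < N" "0 < D"
  shows "(\<integral>\<^sup>+x. ennreal (1 / h_dens N D x) * indicator {D/2..D} x \<partial>lborel)
      \<le> ennreal (4 / N * (D/2) powr (2 - N))"
proof -
  have eq: "(\<integral>\<^sup>+x. ennreal (1 / h_dens N D x) * indicator {D/2..D} x \<partial>lborel)
     = (\<integral>\<^sup>+x. ennreal (x powr (1 - N)) * indicator {D/2..D} x \<partial>lborel)"
    using assms
    by (intro nn_integral_cong)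
      (auto simp: indicator_def h_dens_upper_half powr_minus_divide[symmetric])
  show ?thesis
  proof (cases "N \<le> 4")
    case True
    have "(\<integral>\<^sup>+x. ennreal (x powr (1 - N)) * indicator {D/2..D} x \<partial>lborel)
        \<le> (\<integral>\<^sup>+x. ennreal ((D/2) powr (1 - N)) * indicator {D/2..D} x \<partial>lborel)"
      using assms
      by (intro nn_integral_mono)
        (auto simp: indicator_def intro!: ennreal_leI powr_mono2')
    also have "\<dots> = ennreal ((D/2) powr (1 - N) * (D/2))"
      using assms by (simp add: nn_integral_cmult ennreal_mult[symmetric])
    also have "(D/2) powr (1 - N) * (D/2) = 1 * (D/2) powr (2 - N)"
      using assms powr_add[of "D/2" "1 - N" 1] by simp
    also have "\<dots> \<le> 4 / N * (D/2) powr (2 - N)"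
      using assms True by (intro mult_right_mono) auto
    finally show ?thesis by (simp add: eq ennreal_leI)
  next
    case False
    have "(\<integral>\<^sup>+x. ennreal (x powr (1 - N)) * indicator {D/2..D} x \<partial>lborel)
       = ennreal ((D powr (2 - N) - (D/2) powr (2 - N)) / (2 - N))"
      using assms False by (subst nn_integral_powr_Icc) auto
    also have "(D powr (2 - N) - (D/2) powr (2 - N)) / (2 - N)
        = ((D/2) powr (2 - N) - D powr (2 - N)) / (N - 2)"
      using False by (simp add: field_simps)
    also have "\<dots> \<le> (D/2) powr (2 - N) / (N - 2)"
      using False by (intro divide_right_mono) auto
    also have "\<dots> = (D/2) powr (2 - N) * (1 / (N - 2))" by simp
    also have "\<dots> \<le> (D/2) powr (2 - N) * (4 / N)"
      using False by (intro mult_left_mono) (auto simp: field_simps)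
    finally show ?thesis by (simp add: eq ennreal_leI mult.commute)
  qed
qed

text \<open>On the right half [D/2, x] is enlarged to [D/2, D]; on the left half t -> D - t carries
  [x, D/2] into [D/2, D] and preserves the density. So one constant serves for every
  \<open>x\<close>.\<close>

lemma locally_lipschitz_h_dens_bound:
  assumes "1 < N" "0 < D" and lip: "locally_lipschitz f" and x: "0 \<le> x" "x \<le> D"
  shows "ennreal ((f x - f (D/2))\<^sup>2)
     \<le> (\<integral>\<^sup>+t. ennreal (\<bar>deriv f t\<bar>\<^sup>2 * h_dens N D t) \<partial>lborel)
        * ennreal (4 / N * (D/2) powr (2 - N))"
proof (cases "D/2 \<le> x")
  case True
  have "ennreal ((f x - f (D/2))\<^sup>2) \<le> (\<integral>\<^sup>+t. ennreal (\<bar>deriv f t\<bar>\<^sup>2 * h_dens N D t) \<partial>lborel)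
      * (\<integral>\<^sup>+t. ennreal (1 / h_dens N D t) * indicator {D/2..x} t \<partial>lborel)"
    using assms True by (intro locally_lipschitz_weighted_bound h_dens_pos) auto
  also have "(\<integral>\<^sup>+t. ennreal (1 / h_dens N D t) * indicator {D/2..x} t \<partial>lborel)
      \<le> (\<integral>\<^sup>+t. ennreal (1 / h_dens N D t) * indicator {D/2..D} t \<partial>lborel)"
    using x by (intro nn_integral_mono mult_left_mono) (auto simp: indicator_def)
  also note nn_integral_inverse_h_dens_le[OF assms(1,2)]
  finally show ?thesis by (simp add: mult_left_mono)
next
  case False
  let ?F = "\<lambda>t. ennreal (1 / h_dens N D t) * indicator {D/2..D} t"
  have "ennreal ((f (D/2) - f x)\<^sup>2) \<le> (\<integral>\<^sup>+t. ennreal (\<bar>deriv f t\<bar>\<^sup>2 * h_dens N D t) \<partial>lborel)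
      * (\<integral>\<^sup>+t. ennreal (1 / h_dens N D t) * indicator {x..D/2} t \<partial>lborel)"
    using assms False by (intro locally_lipschitz_weighted_bound h_dens_pos) auto
  also have "(\<integral>\<^sup>+t. ennreal (1 / h_dens N D t) * indicator {x..D/2} t \<partial>lborel)
      \<le> (\<integral>\<^sup>+t. ?F (D - t) \<partial>lborel)"
    using x by (intro nn_integral_mono) (auto simp: indicator_def h_dens_reflect)
  also have "\<dots> = (\<integral>\<^sup>+t. ?F t \<partial>lborel)"
    by (rule nn_integral_lborel_reflect) measurable
  also note nn_integral_inverse_h_dens_le[OF assms(1,2)]
  finally show ?thesis by (simp add: mult_left_mono power2_commute)
qed

text \<open>Expanding the square, the mixed term vanishes by the mean-zero condition, and the right
  side exceeds the left by c^2 times the mass of \<open>h\<close>.\<close>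

lemma nn_integral_variance_le:
  fixes f h :: "'a \<Rightarrow> real"
  assumes f [measurable]: "f \<in> borel_measurable M" and h: "integrable M h" "\<And>x. 0 \<le> h x"
    and fh: "integrable M (\<lambda>x. f x * h x)" "(\<integral>x. f x * h x \<partial>M) = 0"
    and fin: "(\<integral>\<^sup>+x. ennreal ((f x)\<^sup>2 * h x) \<partial>M) < \<infinity>"
  shows "(\<integral>\<^sup>+x. ennreal ((f x)\<^sup>2 * h x) \<partial>M) \<le> (\<integral>\<^sup>+x. ennreal ((f x - c)\<^sup>2 * h x) \<partial>M)"
proof -
  have [measurable]: "h \<in> borel_measurable M" using h(1) by auto
  have i2: "integrable M (\<lambda>x. (f x)\<^sup>2 * h x)"
    using fin h(2) by (intro integrableI_nonneg) auto
  have eq: "(f x - c)\<^sup>2 * h x = (f x)\<^sup>2 * h x - 2 * c * (f x * h x) + c\<^sup>2 * h x" for x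
    by (simp add: power2_eq_square algebra_simps)
  have int: "integrable M (\<lambda>x. (f x - c)\<^sup>2 * h x)"
    unfolding eq using i2 fh(1) h(1) by auto
  have "(\<integral>x. (f x - c)\<^sup>2 * h x \<partial>M) = (\<integral>x. (f x)\<^sup>2 * h x \<partial>M) + c\<^sup>2 * (\<integral>x. h x \<partial>M)"
    unfolding eq using i2 fh h(1) by simp
  then have "(\<integral>x. (f x)\<^sup>2 * h x \<partial>M) \<le> (\<integral>x. (f x - c)\<^sup>2 * h x \<partial>M)"
    using h(2) by (simp add: integral_nonneg_AE)
  then show ?thesis
    using i2 int h(2) by (simp add: nn_integral_eq_integral ennreal_leI)
qed

lemma locally_lipschitz_measurable:
  assumes "locally_lipschitz f"
  shows "f \<in> borel_measurable borel"
  using local_lipschitz_continuous_on[OF assms[unfolded locally_lipschitz_def], of 0]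
  by (simp add: borel_measurable_continuous_onI)

lemma integrable_h_dens:
  assumes "1 < N" "0 < D"
  shows "integrable lborel (h_dens N D)"
proof (rule integrableI_nonneg)
  show "(\<integral>\<^sup>+x. ennreal (h_dens N D x) \<partial>lborel) < \<infinity>"
    using nn_integral_h_dens_le[OF assms] by (rule le_less_trans) simp
qed auto

text \<open>The pointwise bound on (f x - f (D/2))^2 is integrated against the density. The constant
  is the product of the bound for the reciprocal density and the bound for the mass.\<close>

lemma poincare_h_dens:
  assumes "1 < N" "0 < D" and adm: "admissible (h_dens N D) f"
  shows "(\<integral>\<^sup>+x. ennreal ((f x)\<^sup>2 * h_dens N D x) \<partial>lebesgue)
    \<le> (\<integral>\<^sup>+x. ennreal (\<bar>deriv f x\<bar>\<^sup>2 * h_dens N D x) \<partial>lebesgue)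
        * ennreal (4 * D\<^sup>2 * 2 powr (N - 1) / N\<^sup>2)"
proof -
  define E where "E = (\<integral>\<^sup>+t. ennreal (\<bar>deriv f t\<bar>\<^sup>2 * h_dens N D t) \<partial>lborel)"
  define K where "K = ennreal (4 / N * (D/2) powr (2 - N))"
  have lip: "locally_lipschitz f" using adm by (simp add: admissible_def)
  have [measurable]: "f \<in> borel_measurable lborel"
    using locally_lipschitz_measurable[OF lip] by simp
  have fm: "f \<in> borel_measurable lebesgue" by (rule measurable_completion) measurable
  have "(\<integral>\<^sup>+x. ennreal ((f x)\<^sup>2 * h_dens N D x) \<partial>lebesgue)
      \<le> (\<integral>\<^sup>+x. ennreal ((f x - f (D/2))\<^sup>2 * h_dens N D x) \<partial>lebesgue)"
    using adm integrable_completion[of "h_dens N D" lborel] integrable_h_dens[OF assms(1,2)]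
    by (intro nn_integral_variance_le fm) (auto simp: admissible_def)
  also have "\<dots> = (\<integral>\<^sup>+x. ennreal ((f x - f (D/2))\<^sup>2 * h_dens N D x) \<partial>lborel)"
    by (rule nn_integral_completion)
  also have "\<dots> \<le> (\<integral>\<^sup>+x. (E * K) * ennreal (h_dens N D x) \<partial>lborel)"
  proof (rule nn_integral_mono)
    fix x
    show "ennreal ((f x - f (D/2))\<^sup>2 * h_dens N D x) \<le> (E * K) * ennreal (h_dens N D x)"
    proof (cases "0 \<le> x \<and> x \<le> D")
      case True
      then show ?thesis
        using locally_lipschitz_h_dens_bound[OF assms(1,2) lip, of x]
        unfolding E_def[symmetric] K_def[symmetric]
        by (simp add: ennreal_mult mult_right_mono)
    qed (use h_dens_outside[of x D N] assms in auto)
  qed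
  also have "\<dots> = (E * K) * (\<integral>\<^sup>+x. ennreal (h_dens N D x) \<partial>lborel)"
    by (rule nn_integral_cmult) measurable
  also have "\<dots> \<le> (E * K) * ennreal (2 * D powr N / N)"
    by (intro mult_left_mono nn_integral_h_dens_le assms) simp
  also have "\<dots> = E * ennreal (4 / N * (D/2) powr (2 - N) * (2 * D powr N / N))"
    using assms by (simp add: K_def mult.assoc ennreal_mult[symmetric])
  also have "4 / N * (D/2) powr (2 - N) * (2 * D powr N / N) = 4 * D\<^sup>2 * 2 powr (N - 1) / N\<^sup>2"
  proof -
    have "(D/2) powr (2 - N) * D powr N = D powr 2 * 2 powr (N - 2)"
      using assms by (simp add: powr_divide powr_diff field_simps)
    moreover have "2 powr (N - 1) = 2 * 2 powr (N - 2)"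
      by (simp add: powr_diff)
    ultimately show ?thesis
      using assms by (simp add: power2_eq_square field_simps)
  qed
  finally show ?thesis by (simp add: E_def nn_integral_completion)
qed

lemma spectral_gap_lower_bound:
  assumes "1 < N" "0 < D"
  shows "ennreal (N\<^sup>2 / (4 * D\<^sup>2 * 2 powr (N - 1))) \<le> spectral_gap (h_dens N D)"
  unfolding spectral_gap_def
proof (rule INF_greatest)
  fix f assume "f \<in> {f. admissible (h_dens N D) f}"
  then have adm: "admissible (h_dens N D) f" by simp
  define Q where "Q = (\<integral>\<^sup>+x. ennreal ((f x)\<^sup>2 * h_dens N D x) \<partial>lebesgue)"
  define E where "E = (\<integral>\<^sup>+x. ennreal (\<bar>deriv f x\<bar>\<^sup>2 * h_dens N D x) \<partial>lebesgue)"
  define C where "C = 4 * D\<^sup>2 * 2 powr (N - 1) / N\<^sup>2"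
  have "0 < C" using assms by (simp add: C_def)
  have Q: "0 < Q" "Q < \<infinity>" using adm by (auto simp: admissible_def Q_def)
  have QE: "Q \<le> E * ennreal C"
    unfolding Q_def E_def C_def by (rule poincare_h_dens[OF assms adm])
  have "ennreal (1 / C) \<le> E / Q"
  \<comment> \<open>Infinite energy makes the quotient infinite, because \<open>Q\<close> is finite;
    otherwise the claim is real arithmetic.\<close>
  proof (cases E)
    case (real e)
    obtain q where q: "Q = ennreal q" "0 < q" using Q by (cases Q) auto
    have "q \<le> e * C" using QE real q \<open>0 < C\<close> by (simp add: ennreal_mult[symmetric])
    then have "1 / C \<le> e / q" using q \<open>0 < C\<close> by (simp add: field_simps)
    then show ?thesis using real q by (simp add: divide_ennreal ennreal_leI)
  next
    case top
    then show ?thesis using Q by (simp add: ennreal_top_divide)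
  qed
  then show "ennreal (N\<^sup>2 / (4 * D\<^sup>2 * 2 powr (N - 1)))
     \<le> (\<integral>\<^sup>+x. ennreal (\<bar>deriv f x\<bar>\<^sup>2 * h_dens N D x) \<partial>lebesgue)
        / (\<integral>\<^sup>+x. ennreal ((f x)\<^sup>2 * h_dens N D x) \<partial>lebesgue)"
    by (simp add: C_def Q_def E_def)
qed

subsection \<open>The upper bound\<close>

lemma spectral_gap_le:
  assumes adm: "admissible h f"
    and le: "(\<integral>\<^sup>+x. ennreal (\<bar>deriv f x\<bar>\<^sup>2 * h x) \<partial>lebesgue)
        \<le> ennreal r * (\<integral>\<^sup>+x. ennreal ((f x)\<^sup>2 * h x) \<partial>lebesgue)"
  shows "spectral_gap h \<le> ennreal r"
  unfolding spectral_gap_def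
proof (rule INF_lower2)
  show "f \<in> {f. admissible h f}" using adm by simp
  show "(\<integral>\<^sup>+x. ennreal (\<bar>deriv f x\<bar>\<^sup>2 * h x) \<partial>lebesgue)
      / (\<integral>\<^sup>+x. ennreal ((f x)\<^sup>2 * h x) \<partial>lebesgue) \<le> ennreal r"
    using adm le by (intro divide_le_posI_ennreal) (auto simp: admissible_def mult.commute)
qed

lemma lipschitz_imp_locally_lipschitz:
  assumes "L-lipschitz_on UNIV f"
  shows "locally_lipschitz f"
  unfolding locally_lipschitz_def
  by (rule local_lipschitzI)
    (intro exI[of _ "1::real"] exI[of _ L] conjI ballI lipschitz_on_subset[OF assms]; simp)

text \<open>Oddness about D/2 against a density symmetric about D/2 makes the mean vanish, and |f|
  <= 1 lets the mass of the density dominate both integrals.\<close>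

lemma admissible_h_dens_odd:
  assumes "1 < N" "0 < D" and lip: "locally_lipschitz f"
    and odd: "\<And>x. f (D - x) = - f x" and bnd: "\<And>x. \<bar>f x\<bar> \<le> 1"
    and pos: "0 < (\<integral>\<^sup>+x. ennreal ((f x)\<^sup>2 * h_dens N D x) \<partial>lborel)"
  shows "admissible (h_dens N D) f"
proof -
  have [measurable]: "f \<in> borel_measurable borel" by (rule locally_lipschitz_measurable[OF lip])
  have int: "integrable lborel (\<lambda>x. f x * h_dens N D x)"
    by (rule Bochner_Integration.integrable_bound[OF integrable_h_dens[OF assms(1,2)]])
      (auto intro!: AE_I2 mult_left_le_one_le simp: abs_mult bnd)
  have "(\<integral>x. f x * h_dens N D x \<partial>lborel) = (\<integral>x. f (D - x) * h_dens N D (D - x) \<partial>lborel)"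
    using lborel_integral_real_affine[of "-1" "\<lambda>x. f x * h_dens N D x" D] by simp
  also have "\<dots> = - (\<integral>x. f x * h_dens N D x \<partial>lborel)"
    by (simp add: odd h_dens_reflect)
  finally have zero: "(\<integral>x. f x * h_dens N D x \<partial>lborel) = 0" by simp
  have "(\<integral>\<^sup>+x. ennreal ((f x)\<^sup>2 * h_dens N D x) \<partial>lborel) \<le> (\<integral>\<^sup>+x. ennreal (h_dens N D x) \<partial>lborel)"
    using bnd by (intro nn_integral_mono ennreal_leI mult_left_le_one_le) (auto simp: abs_square_le_1)
  also have "\<dots> < \<infinity>"
    using nn_integral_h_dens_le[OF assms(1,2)] by (rule le_less_trans) simp
  finally show ?thesis
    using lip int zero pos
    by (simp add: admissible_def nn_integral_completion integrable_completion integral_completion)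
qed

section \<open>The cosine test function\<close>

lemma h_dens_ge:
  assumes "1 < N" "0 < D" "0 \<le> x" "x \<le> D"
  shows "(D/2) powr (N - 1) \<le> h_dens N D x"
  using assms by (auto simp: h_dens_def intro!: powr_mono2)

text \<open>A Chebyshev-type argument: \<open>c\<close> is the value of the density at D/4 and 3D/4,
  exactly where the cosine changes sign. Hence cosine and density minus \<open>c\<close> have the
  same sign on [0, D], and subtracting \<open>c\<close> costs nothing as the cosine runs through a
  full period.\<close>

lemma integral_cos_h_dens_nonneg:
  assumes "1 < N" "0 < D"
  shows "0 \<le> (\<integral>x. cos (2 * (pi * x / D)) * h_dens N D x \<partial>lborel)"
proof -
  define c where "c = (3 * D / 4) powr (N - 1)"
  have int: "integrable lborel (\<lambda>x. cos (2 * (pi * x / D)) * h_dens N D x)"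
    by (rule Bochner_Integration.integrable_bound[OF integrable_h_dens[OF assms]])
      (auto intro!: AE_I2 mult_left_le_one_le simp: abs_mult)
  have bi: "has_bochner_integral lborel (\<lambda>x. cos (2 * (pi * x / D)) * indicator {0..D} x)
      (D / (2 * pi) * sin (2 * (pi * D / D)) - D / (2 * pi) * sin (2 * (pi * 0 / D)))"
    using assms
    by (intro has_bochner_integral_FTC_Icc_real)
      (auto intro!: derivative_eq_intros continuous_intros simp: field_simps)
  have "0 \<le> (\<integral>x. cos (2 * (pi * x / D)) * h_dens N D x
        - c * (cos (2 * (pi * x / D)) * indicator {0..D} x) \<partial>lborel)"
  proof (rule integral_nonneg_AE, rule AE_I2)
    fix x
    show "0 \<le> cos (2 * (pi * x / D)) * h_dens N D x
        - c * (cos (2 * (pi * x / D)) * indicator {0..D} x)"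
    proof (cases "x \<in> {0..D}")
      case True
      consider "x \<le> D/4" | "D/4 \<le> x" "x \<le> 3*D/4" | "3*D/4 \<le> x" by linarith
      then have "0 \<le> cos (2 * (pi * x / D)) * (h_dens N D x - c)"
      proof cases
        case 1
        then have "0 \<le> cos (2 * (pi * x / D))"
          using assms True by (intro cos_ge_zero) (auto simp: field_simps intro: order_trans[of _ 0])
        moreover have "c \<le> h_dens N D x"
          using assms True 1 by (auto simp: h_dens_def c_def intro!: powr_mono2)
        ultimately show ?thesis by simp
      next
        case 2
        have "0 \<le> cos (pi - 2 * (pi * x / D))"
          using assms 2 by (intro cos_ge_zero) (auto simp: field_simps)
        then have "cos (2 * (pi * x / D)) \<le> 0" by simp
        moreover have "h_dens N D x \<le> c"
          using assms True 2 by (auto simp: h_dens_def c_def intro!: powr_mono2)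
        ultimately show ?thesis by (simp add: mult_nonpos_nonpos)
      next
        case 3
        have "0 \<le> cos (2 * pi - 2 * (pi * x / D))"
          using assms True 3 by (intro cos_ge_zero) (auto simp: field_simps intro: order_trans[of _ 0])
        then have "0 \<le> cos (2 * (pi * x / D))" by (simp add: cos_diff)
        moreover have "c \<le> h_dens N D x"
          using assms True 3 by (auto simp: h_dens_def c_def intro!: powr_mono2)
        ultimately show ?thesis by simp
      qed
      then show ?thesis using True by (simp add: algebra_simps)
    next
      case False
      then show ?thesis using h_dens_outside[of x D N] assms by auto
    qed
  qed
  also have "\<dots> = (\<integral>x. cos (2 * (pi * x / D)) * h_dens N D x \<partial>lborel)
      - c * (\<integral>x. cos (2 * (pi * x / D)) * indicator {0..D} x \<partial>lborel)"
    using int bi by (subst Bochner_Integration.integral_diff) (auto simp: has_bochner_integral_iff)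
  also have "(\<integral>x. cos (2 * (pi * x / D)) * indicator {0..D} x \<partial>lborel) = 0"
    using bi assms by (simp add: has_bochner_integral_iff)
  finally show ?thesis by simp
qed

text \<open>The energy of cos (pi x / D) is pi^2 / D^2 times the integral of sin^2 against the
  density. Since cos^2 - sin^2 is the cosine of the double angle, the preceding lemma lets cos^2
  replace sin^2.\<close>

lemma spectral_gap_le_cos:
  assumes "1 < N" "0 < D"
  shows "spectral_gap (h_dens N D) \<le> ennreal (pi\<^sup>2 / D\<^sup>2)"
proof -
  define f where "f = (\<lambda>x. cos (pi * x / D))"
  let ?h = "h_dens N D"
  have der: "(f has_real_derivative - (pi / D) * sin (pi * x / D)) (at x)" for x
    unfolding f_def using assms by (auto intro!: derivative_eq_intros)
  have "(pi / D)-lipschitz_on UNIV f"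
  proof (rule lipschitz_onI)
    fix x y :: real
    have "norm (f x - f y) \<le> pi / D * norm (x - y)"
      by (rule field_differentiable_bound[of UNIV f "\<lambda>x. - (pi / D) * sin (pi * x / D)"])
        (use der assms in \<open>auto simp: abs_mult intro!: mult_left_le divide_right_mono\<close>)
    then show "dist (f x) (f y) \<le> pi / D * dist x y" by (simp add: dist_norm)
  qed (use assms in auto)
  then have lip: "locally_lipschitz f" by (rule lipschitz_imp_locally_lipschitz)
  have [measurable]: "f \<in> borel_measurable borel" by (rule locally_lipschitz_measurable[OF lip])
  \<comment> \<open>On [0, D/4] the squared cosine is at least 1/2 and the density at least its
    minimum (D/2)^(N-1).\<close>
  have "0 < ennreal (1 / 2 * (D/2) powr (N - 1) * (D / 4))"
    using assms by simp
  also have "\<dots> = (\<integral>\<^sup>+x. ennreal (1 / 2 * (D/2) powr (N - 1)) * indicator {0..D/4} x \<partial>lborel)"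
    using assms by (simp add: nn_integral_cmult ennreal_mult[symmetric])
  also have "\<dots> \<le> (\<integral>\<^sup>+x. ennreal ((f x)\<^sup>2 * ?h x) \<partial>lborel)"
  proof (rule nn_integral_mono)
    fix x
    show "ennreal (1 / 2 * (D/2) powr (N - 1)) * indicator {0..D/4} x \<le> ennreal ((f x)\<^sup>2 * ?h x)"
    proof (cases "x \<in> {0..D/4}")
      case True
      have "0 \<le> cos (2 * (pi * x / D))"
        using assms True by (intro cos_ge_zero) (auto simp: field_simps intro: order_trans[of _ 0])
      then have "1 / 2 \<le> (f x)\<^sup>2" using cos_double_cos[of "pi * x / D"] by (simp add: f_def)
      then have "1 / 2 * (D/2) powr (N - 1) \<le> (f x)\<^sup>2 * ?h x"
        using True assms by (intro mult_mono h_dens_ge) auto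
      then show ?thesis using True by (simp add: ennreal_leI)
    qed simp
  qed
  finally have pos: "0 < (\<integral>\<^sup>+x. ennreal ((f x)\<^sup>2 * ?h x) \<partial>lborel)" .
  have adm: "admissible ?h f"
  proof (rule admissible_h_dens_odd[OF assms lip _ _ pos])
    show "f (D - x) = - f x" for x
    proof -
      have "pi * (D - x) / D = pi - pi * x / D" using assms by (simp add: field_simps)
      then show ?thesis by (simp add: f_def)
    qed
  qed (simp add: f_def)
  have ic: "integrable lborel (\<lambda>x. (f x)\<^sup>2 * ?h x)"
    by (rule Bochner_Integration.integrable_bound[OF integrable_h_dens[OF assms]])
      (auto intro!: AE_I2 mult_left_le_one_le simp: abs_mult f_def abs_square_le_1)
  have isin: "integrable lborel (\<lambda>x. (sin (pi * x / D))\<^sup>2 * ?h x)"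
    by (rule Bochner_Integration.integrable_bound[OF integrable_h_dens[OF assms]])
      (auto intro!: AE_I2 mult_left_le_one_le simp: abs_mult abs_square_le_1)
  have "(\<integral>x. cos (2 * (pi * x / D)) * ?h x \<partial>lborel)
      = (\<integral>x. (f x)\<^sup>2 * ?h x - (sin (pi * x / D))\<^sup>2 * ?h x \<partial>lborel)"
    unfolding cos_double f_def left_diff_distrib by (rule refl)
  then have "(\<integral>x. (sin (pi * x / D))\<^sup>2 * ?h x \<partial>lborel) \<le> (\<integral>x. (f x)\<^sup>2 * ?h x \<partial>lborel)"
    using integral_cos_h_dens_nonneg[OF assms] ic isin by simp
  then have le: "(\<integral>\<^sup>+x. ennreal ((sin (pi * x / D))\<^sup>2 * ?h x) \<partial>lborel)
      \<le> (\<integral>\<^sup>+x. ennreal ((f x)\<^sup>2 * ?h x) \<partial>lborel)"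
    using ic isin by (simp add: nn_integral_eq_integral ennreal_leI)
  have eq: "ennreal (\<bar>deriv f x\<bar>\<^sup>2 * ?h x)
      = ennreal (pi\<^sup>2 / D\<^sup>2) * ennreal ((sin (pi * x / D))\<^sup>2 * ?h x)" for x
    by (simp add: DERIV_imp_deriv[OF der] power_mult_distrib power_divide ennreal_mult[symmetric]
      mult.assoc)
  have "(\<integral>\<^sup>+x. ennreal (\<bar>deriv f x\<bar>\<^sup>2 * ?h x) \<partial>lborel)
      = ennreal (pi\<^sup>2 / D\<^sup>2) * (\<integral>\<^sup>+x. ennreal ((sin (pi * x / D))\<^sup>2 * ?h x) \<partial>lborel)"
    unfolding eq by (rule nn_integral_cmult) measurable
  also have "\<dots> \<le> ennreal (pi\<^sup>2 / D\<^sup>2) * (\<integral>\<^sup>+x. ennreal ((f x)\<^sup>2 * ?h x) \<partial>lborel)"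
    by (intro mult_left_mono le) simp
  finally show ?thesis
    by (intro spectral_gap_le[OF adm]) (simp add: nn_integral_completion)
qed

section \<open>The piecewise linear cutoff function\<close>

lemma one_plus_inverse_powr_le_exp:
  fixes N s :: real
  assumes "0 < N" "0 \<le> s" "s \<le> N"
  shows "(1 + 1 / N) powr s \<le> exp 1"
proof -
  have "s * ln (1 + 1 / N) \<le> s * (1 / N)"
    using assms by (intro mult_left_mono ln_add_one_self_le_self) auto
  also have "\<dots> \<le> 1" using assms by (simp add: field_simps)
  finally show ?thesis using assms by (simp add: powr_def add_pos_pos)
qed

text \<open>Within distance \<open>d\<close> of the centre the density grows by at most the factor
  e, which bounds the energy, while the mass bound uses only the region outside this strip, where f
  is 1 or -1. The hypothesis N >= 3 ensures that this region keeps a fixed share of D^N / N.\<close>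

lemma spectral_gap_le_cutoff:
  assumes "3 \<le> N" "0 < D"
  shows "spectral_gap (h_dens N D) \<le> ennreal (pi\<^sup>2 * N\<^sup>2 * 2 powr (- (N - 1)) / D\<^sup>2)"
proof -
  let ?h = "h_dens N D"
  define d where "d = D / (2 * N)"
  define f where "f = (\<lambda>x. max (- 1) (min 1 ((x - D/2) / d)))"
  have "0 < d" "1 < N" using assms by (auto simp: d_def)
  have "D/2 + d \<le> D" using assms by (simp add: d_def field_simps)
  have D2d: "D/2 + d = D/2 * (1 + 1 / N)" using assms by (simp add: d_def field_simps)
  have "(1/d)-lipschitz_on UNIV f"
  proof (rule lipschitz_onI)
    fix x y :: real
    have "dist (f x) (f y) \<le> \<bar>(x - D/2) / d - (y - D/2) / d\<bar>"
      by (auto simp: f_def dist_real_def)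
    also have "\<dots> = 1 / d * dist x y"
      using \<open>0 < d\<close> by (simp add: diff_divide_distrib[symmetric] dist_real_def abs_divide)
    finally show "dist (f x) (f y) \<le> 1 / d * dist x y" .
  qed (use \<open>0 < d\<close> in auto)
  then have lip: "locally_lipschitz f" by (rule lipschitz_imp_locally_lipschitz)
  have [measurable]: "f \<in> borel_measurable borel" by (rule locally_lipschitz_measurable[OF lip])
  \<comment> \<open>Bounds the growth of powers from D/2 to D/2 + d; needed for \<open>s = N\<close>
    in the mass and \<open>s = N - 1\<close> in the energy.\<close>
  have e: "(1 + 1 / N) powr s \<le> 272 / 100" if "0 \<le> s" "s \<le> N" for s
    using one_plus_inverse_powr_le_exp[of N s] that \<open>1 < N\<close> e_less_272 by simp

  (* 132/100 = 2 (1 - 2.72 / 8), where exp 1 < 2.72 and 8 \<le> 2 powr N *)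
  define q where "q = 132 / 100 * D powr N / N"
  define k where "k = (\<lambda>x. ennreal (x powr (N - 1)) * indicator {D/2 + d..D} x)"
  have [measurable]: "k \<in> borel_measurable borel" unfolding k_def by measurable
  have "0 < q" using assms by (simp add: q_def)
  have "(D/2 + d) powr N = (D/2) powr N * (1 + 1 / N) powr N"
    unfolding D2d by (rule powr_mult)
  also have "\<dots> \<le> (D/2) powr N * (272 / 100)"
    using assms by (intro mult_left_mono e) auto
  also have "(D/2) powr N = D powr N / 2 powr N"
    using assms by (simp add: powr_divide)
  also have "\<dots> * (272 / 100) \<le> D powr N / 8 * (272 / 100)"
  proof -
    have "2 powr 3 \<le> (2::real) powr N" using assms by (intro powr_mono) auto
    then show ?thesis by (intro mult_right_mono divide_left_mono) auto
  qed
  finally have "q \<le> 2 * ((D powr N - (D/2 + d) powr N) / N)"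
    using assms by (simp add: q_def divide_right_mono field_simps)
  then have "ennreal q \<le> 2 * ennreal ((D powr N - (D/2 + d) powr N) / N)"
    by (metis ennreal_leI ennreal_mult'' ennreal_numeral zero_le_numeral ennreal_mult')
  also have "ennreal ((D powr N - (D/2 + d) powr N) / N) = (\<integral>\<^sup>+x. k x \<partial>lborel)"
    unfolding k_def using \<open>0 < d\<close> \<open>1 < N\<close> \<open>0 < D\<close> \<open>D/2 + d \<le> D\<close>
    by (subst nn_integral_powr_Icc) auto
  also have "2 * \<dots> = (\<integral>\<^sup>+x. k x \<partial>lborel) + (\<integral>\<^sup>+x. k (D - x) \<partial>lborel)"
    by (simp add: nn_integral_lborel_reflect mult_2)
  also have "\<dots> = (\<integral>\<^sup>+x. k x + k (D - x) \<partial>lborel)"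
    by (rule nn_integral_add[symmetric]) auto
  also have "\<dots> \<le> (\<integral>\<^sup>+x. ennreal ((f x)\<^sup>2 * ?h x) \<partial>lborel)"
  proof (rule nn_integral_mono)
    fix x
    have "f x = 1" if "D/2 + d \<le> x" using that \<open>0 < d\<close> by (simp add: f_def field_simps)
    moreover have "f x = - 1" if "D/2 + d \<le> D - x"
    proof -
      have "(x - D/2) / d \<le> - 1" using that \<open>0 < d\<close> by (simp add: field_simps)
      then show ?thesis by (simp add: f_def)
    qed
    \<comment> \<open>As \<open>d\<close> is positive, at most one of the two summands is
      nonzero.\<close>
    ultimately show "k x + k (D - x) \<le> ennreal ((f x)\<^sup>2 * ?h x)"
      using \<open>0 < d\<close> \<open>0 < D\<close> by (auto simp: k_def indicator_def h_dens_def)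
  qed
  finally have Q: "ennreal q \<le> (\<integral>\<^sup>+x. ennreal ((f x)\<^sup>2 * ?h x) \<partial>lborel)" .

  have adm: "admissible ?h f"
  proof (rule admissible_h_dens_odd[OF \<open>1 < N\<close> \<open>0 < D\<close> lip])
    show "0 < (\<integral>\<^sup>+x. ennreal ((f x)\<^sup>2 * ?h x) \<partial>lborel)"
      using Q \<open>0 < q\<close> by (auto intro: less_le_trans[rotated])
    show "f (D - x) = - f x" for x
    proof -
      have "(D - x - D/2) / d = - ((x - D/2) / d)" using \<open>0 < d\<close> by (simp add: field_simps)
      then show ?thesis unfolding f_def by (simp only: max_def min_def) auto
    qed
  qed (auto simp: f_def)

  \<comment> \<open>The squared slope times the maximum of the density on the transition
    strip.\<close>
  define b where "b = (1/d)\<^sup>2 * (D/2 + d) powr (N - 1)"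
  have "(\<integral>\<^sup>+x. ennreal (\<bar>deriv f x\<bar>\<^sup>2 * ?h x) \<partial>lborel)
     \<le> (\<integral>\<^sup>+x. ennreal b * indicator {D/2 - d..D/2 + d} x \<partial>lborel)"
  proof (rule nn_integral_mono_AE)
    \<comment> \<open>The kinks of \<open>f\<close> are excluded.\<close>
    have ne: "AE x in lborel. x \<noteq> D/2 - d" "AE x in lborel. x \<noteq> D/2 + d"
      by (rule AE_lborel_singleton)+
    show "AE x in lborel. ennreal (\<bar>deriv f x\<bar>\<^sup>2 * ?h x)
        \<le> ennreal b * indicator {D/2 - d..D/2 + d} x"
      using ne
    proof eventually_elim
      case (elim x)
      then consider "x < D/2 - d" | "x \<in> {D/2 - d<..<D/2 + d}" | "D/2 + d < x" by force
      then show ?case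
      proof cases
        case 1
        have "(f has_real_derivative 0) (at x)"
          by (rule has_field_derivative_transform_within_open[of "\<lambda>_. - 1" _ _ "{..<D/2 - d}"])
            (use 1 \<open>0 < d\<close> in \<open>auto simp: f_def field_simps max_def min_def\<close>)
        then show ?thesis by (simp add: DERIV_imp_deriv)
      next
        case 2
        have "(f has_real_derivative 1/d) (at x)"
          by (rule has_field_derivative_transform_within_open
              [of "\<lambda>x. (x - D/2) / d" _ _ "{D/2 - d<..<D/2 + d}"])
            (use 2 \<open>0 < d\<close> in \<open>auto simp: f_def field_simps max_def min_def intro!: derivative_eq_intros\<close>)
        moreover have "?h x \<le> (D/2 + d) powr (N - 1)"
          using 2 \<open>1 < N\<close> \<open>0 < D\<close> by (auto simp: h_dens_def intro!: powr_mono2)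
        ultimately show ?thesis
          using 2 by (simp add: DERIV_imp_deriv b_def ennreal_leI mult_left_mono)
      next
        case 3
        have "(f has_real_derivative 0) (at x)"
          by (rule has_field_derivative_transform_within_open[of "\<lambda>_. 1" _ _ "{D/2 + d<..}"])
            (use 3 \<open>0 < d\<close> in \<open>auto simp: f_def field_simps max_def min_def\<close>)
        then show ?thesis by (simp add: DERIV_imp_deriv)
      qed
    qed
  qed
  also have "\<dots> = ennreal (b * (2 * d))"
    using \<open>0 < d\<close> by (simp add: b_def nn_integral_cmult ennreal_mult[symmetric])
  also have "\<dots> \<le> ennreal (pi\<^sup>2 * N\<^sup>2 * 2 powr (- (N - 1)) / D\<^sup>2 * q)"
  \<comment> \<open>After removal of the common factor the claim is 4 * 2.72 = 10.88 <= 1.32 pi^2,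
    and pi > 3 makes the right side at least 11.88.\<close>
  proof (rule ennreal_leI)
    have "b * (2 * d) = 2 / d * (D/2 + d) powr (N - 1)"
      using \<open>0 < d\<close> by (simp add: b_def power2_eq_square)
    also have "(D/2 + d) powr (N - 1) = (D/2) powr (N - 1) * (1 + 1 / N) powr (N - 1)"
      unfolding D2d by (rule powr_mult)
    also have "2 / d * \<dots> \<le> 2 / d * ((D/2) powr (N - 1) * (272 / 100))"
      using assms \<open>0 < d\<close> by (intro mult_left_mono e) auto
    also have "\<dots> = 1088 / 100 * (N * (D/2) powr (N - 1) / D)"
      using assms by (simp add: d_def field_simps)
    also have "\<dots> \<le> pi\<^sup>2 * 132 / 100 * (N * (D/2) powr (N - 1) / D)"
    proof (rule mult_right_mono)
      have "3\<^sup>2 \<le> pi\<^sup>2" using pi_gt3 by (intro power_mono) auto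
      then show "1088 / 100 \<le> pi\<^sup>2 * 132 / 100" by simp
    qed (use assms in auto)
    also have "\<dots> = pi\<^sup>2 * N\<^sup>2 * 2 powr (- (N - 1)) / D\<^sup>2 * q"
    proof -
      have "(D/2) powr (N - 1) = D powr N / D * 2 powr (- (N - 1))"
        using assms by (simp add: powr_divide powr_diff)
      then show ?thesis using assms by (simp add: q_def power2_eq_square field_simps)
    qed
    finally show "b * (2 * d) \<le> pi\<^sup>2 * N\<^sup>2 * 2 powr (- (N - 1)) / D\<^sup>2 * q" .
  qed
  also have "ennreal (pi\<^sup>2 * N\<^sup>2 * 2 powr (- (N - 1)) / D\<^sup>2 * q)
      = ennreal (pi\<^sup>2 * N\<^sup>2 * 2 powr (- (N - 1)) / D\<^sup>2) * ennreal q"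
    using \<open>0 < q\<close> by (intro ennreal_mult) auto
  also have "\<dots> \<le> ennreal (pi\<^sup>2 * N\<^sup>2 * 2 powr (- (N - 1)) / D\<^sup>2)
      * (\<integral>\<^sup>+x. ennreal ((f x)\<^sup>2 * ?h x) \<partial>lborel)"
    by (intro mult_left_mono Q) simp
  finally show ?thesis
    by (intro spectral_gap_le[OF adm]) (simp add: nn_integral_completion)
qed

text \<open>Up to N = 2 the chord of the convex exponential between 0 and ln 2 gives 2^(N-1) <= N;
  beyond 2 the number 4 separates the two sides.\<close>

lemma two_powr_le_square:
  fixes N :: real
  assumes "1 \<le> N" "N \<le> 3"
  shows "2 powr (N - 1) \<le> N\<^sup>2"
proof (cases "N \<le> 2")
  case True
  have "2 powr (N - 1) = exp ((N - 1) * ln 2)" by (simp add: powr_def)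
  also have "\<dots> \<le> 1 + (N - 1) * (exp (ln 2) - 1)"
  proof -
    have "exp ((1 - (N - 1)) *\<^sub>R 0 + (N - 1) *\<^sub>R ln 2)
        \<le> (1 - (N - 1)) * exp 0 + (N - 1) * exp (ln 2 :: real)"
      by (rule convex_onD[OF exp_convex]) (use assms True in auto)
    then show ?thesis by (simp add: algebra_simps)
  qed
  also have "\<dots> = N * 1" by simp
  also have "\<dots> \<le> N * N" using assms by (intro mult_left_mono) auto
  finally show ?thesis by (simp add: power2_eq_square)
next
  case False
  have "2 powr (N - 1) \<le> (2::real) powr 2" using assms by (intro powr_mono) auto
  also have "\<dots> = 2\<^sup>2" by simp
  also have "\<dots> \<le> N\<^sup>2" using False by (intro power_mono) auto
  finally show ?thesis .
qed

text \<open>For N <= 3 the factor N^2 2^(1-N) is at least 1, so the cosine bound pi^2 / D^2 is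
  strong enough; the cutoff covers the rest.\<close>

lemma spectral_gap_upper_bound:
  assumes "1 < N" "0 < D"
  shows "spectral_gap (h_dens N D) \<le> ennreal (pi\<^sup>2 * N\<^sup>2 * 2 powr (- (N - 1)) / D\<^sup>2)"
proof (cases "N \<le> 3")
  case True
  have "1 \<le> N\<^sup>2 * 2 powr (- (N - 1))"
    using two_powr_le_square[of N] powr_minus_divide[of 2 "N - 1"] True assms by simp
  then have "pi\<^sup>2 / D\<^sup>2 * 1 \<le> pi\<^sup>2 / D\<^sup>2 * (N\<^sup>2 * 2 powr (- (N - 1)))"
    by (intro mult_left_mono) auto
  then show ?thesis
    using spectral_gap_le_cos[OF assms]
    by (elim order_trans) (simp add: ennreal_leI mult.assoc)
qed (use spectral_gap_le_cutoff assms in simp)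

theorem lemma5p2:
  fixes N D :: real
  assumes "1 < N" and "0 < D"
  shows "ennreal (pi\<^sup>2 * N\<^sup>2 * 2 powr (- (N - 1))) \<ge> ennreal (D\<^sup>2) * spectral_gap (h_dens N D)
       \<and> ennreal (D\<^sup>2) * spectral_gap (h_dens N D) \<ge> ennreal (1 / 4 * N\<^sup>2 * 2 powr (- (N - 1)))"
proof
  have "ennreal (D\<^sup>2) * spectral_gap (h_dens N D)
      \<le> ennreal (D\<^sup>2) * ennreal (pi\<^sup>2 * N\<^sup>2 * 2 powr (- (N - 1)) / D\<^sup>2)"
    by (intro mult_left_mono spectral_gap_upper_bound assms) simp
  also have "\<dots> = ennreal (pi\<^sup>2 * N\<^sup>2 * 2 powr (- (N - 1)))"
    using assms by (simp add: ennreal_mult[symmetric])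
  finally show "ennreal (D\<^sup>2) * spectral_gap (h_dens N D) \<le> ennreal (pi\<^sup>2 * N\<^sup>2 * 2 powr (- (N - 1)))" .
  have "ennreal (1 / 4 * N\<^sup>2 * 2 powr (- (N - 1)))
      = ennreal (D\<^sup>2) * ennreal (N\<^sup>2 / (4 * D\<^sup>2 * 2 powr (N - 1)))"
    using assms powr_minus_divide[of 2 "N - 1"] by (simp add: ennreal_mult[symmetric])
  also have "\<dots> \<le> ennreal (D\<^sup>2) * spectral_gap (h_dens N D)"
    by (intro mult_left_mono spectral_gap_lower_bound assms) simp
  finally show "ennreal (1 / 4 * N\<^sup>2 * 2 powr (- (N - 1)))
      \<le> ennreal (D\<^sup>2) * spectral_gap (h_dens N D)" .
qed

end
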